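(* Let $H\in\mathbb{R}^{d\times d}$ be symmetric, $s\in\mathbb{R}$, and let $A=H-sI$. Set $R=\operatorname{sign}(A)$, let $\widetilde R\in\mathbb{R}^{d\times d}$ be any symmetric matrix (a reflector surrogate), and let $g\in\mathbb{R}^d$. For the exact and approximate search directions $d_{\mathrm{ex}}=-Rg$ and $d_{\mathrm{ap}}=-\widetilde Rg$, $$\|d_{\mathrm{ap}}-d_{\mathrm{ex}}\|_2\le\|\widetilde R-R\|_2\,\|g\|_2.$$
   Context: For a symmetric matrix $A=Q\operatorname{diag}(\mu_i)Q^T$ ($Q$ orthogonal), $\operatorname{sign}(A)=Q\operatorname{diag}(\operatorname{sign}(\mu_i))Q^T$ (convention $\operatorname{sign}(0)=0$). $\|\cdot\|_2$ denotes the Euclidean norm of vectors and the spectral norm of matrices. *)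

theory Defs
  imports "HOL-Analysis.Analysis"
begin

definition diag_matrix :: "real ^ 'n \<Rightarrow> real ^ 'n ^ 'n" where
  "diag_matrix \<mu> = (\<chi> i j. if i = j then \<mu> $ i else 0)"

(* The value does not depend on the choice of Q and \<mu>, and is thus specified by THE;
   for symmetric A such R exists and is unique, see matrix_sign_eqI and matrix_sign_ex1.
   The library function sgn satisfies sgn 0 = 0. *)
definition matrix_sign :: "real ^ 'n ^ 'n \<Rightarrow> real ^ 'n ^ 'n" where
  "matrix_sign A = (THE R. \<exists>Q \<mu>. orthogonal_matrix Q
      \<and> A = Q ** diag_matrix \<mu> ** transpose Q
      \<and> R = Q ** diag_matrix (\<chi> i. sgn (\<mu> $ i)) ** transpose Q)"

(* The library's norm on real ^ 'n ^ 'n is the Frobenius norm, whereas the spectral norm is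
   the operator norm induced by the Euclidean norm. *)
definition spectral_norm :: "real ^ 'n ^ 'm \<Rightarrow> real" where
  "spectral_norm A = onorm (\<lambda>x. A *v x)"

lemma diag_matrix_mult_left: "(diag_matrix \<mu> ** M) $ i $ j = \<mu> $ i * M $ i $ j"
  by (simp add: matrix_matrix_mult_def diag_matrix_def if_distrib[of "\<lambda>x. x * _"]
      if_distrib[of "\<lambda>x. _ * x"] cong: if_cong)

lemma diag_matrix_mult_right: "(M ** diag_matrix \<mu>) $ i $ j = M $ i $ j * \<mu> $ j"
  by (simp add: matrix_matrix_mult_def diag_matrix_def if_distrib[of "\<lambda>x. x * _"]
      if_distrib[of "\<lambda>x. _ * x"] cong: if_cong)

lemma matrix_sign_unique:
  fixes P Q :: "real ^ 'n ^ 'n"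
  assumes P: "orthogonal_matrix P" and Q: "orthogonal_matrix Q"
    and eq: "Q ** diag_matrix \<mu> ** transpose Q = P ** diag_matrix \<nu> ** transpose P"
  shows "Q ** diag_matrix (\<chi> i. sgn (\<mu> $ i)) ** transpose Q
       = P ** diag_matrix (\<chi> i. sgn (\<nu> $ i)) ** transpose P"
proof -
  define U where "U = transpose Q ** P"
  have PP: "transpose P ** P = mat 1" "P ** transpose P = mat 1"
    and QQ: "transpose Q ** Q = mat 1" "Q ** transpose Q = mat 1"
    using P Q by (auto simp: orthogonal_matrix_def)
  have "diag_matrix \<mu> ** U = transpose Q ** (Q ** diag_matrix \<mu> ** transpose Q) ** P"
    by (simp add: U_def matrix_mul_assoc QQ)
  also have "\<dots> = transpose Q ** (P ** diag_matrix \<nu> ** transpose P) ** P"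
    by (simp only: eq)
  also have "\<dots> = U ** diag_matrix \<nu> ** (transpose P ** P)"
    by (simp only: U_def matrix_mul_assoc)
  finally have U: "diag_matrix \<mu> ** U = U ** diag_matrix \<nu>"
    by (simp add: PP)
  have ij: "sgn (\<mu> $ i) * U $ i $ j = U $ i $ j * sgn (\<nu> $ j)" for i j
  proof -
    have "\<mu> $ i * U $ i $ j = U $ i $ j * \<nu> $ j"
      using arg_cong[OF U, of "\<lambda>M. M $ i $ j"]
      by (simp add: diag_matrix_mult_left diag_matrix_mult_right)
    then show ?thesis by (cases "U $ i $ j = 0") auto
  qed
  have S: "diag_matrix (\<chi> i. sgn (\<mu> $ i)) ** U = U ** diag_matrix (\<chi> i. sgn (\<nu> $ i))"
    by (simp add: vec_eq_iff diag_matrix_mult_left diag_matrix_mult_right ij)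
  have QU: "Q ** U = P"
    by (simp add: U_def matrix_mul_assoc QQ)
  have UP: "U ** transpose P = transpose Q"
    by (simp add: U_def flip: matrix_mul_assoc) (simp add: PP)
  have "Q ** diag_matrix (\<chi> i. sgn (\<mu> $ i)) ** transpose Q
      = Q ** (diag_matrix (\<chi> i. sgn (\<mu> $ i)) ** U) ** transpose P"
    by (simp add: UP flip: matrix_mul_assoc)
  also have "\<dots> = Q ** U ** diag_matrix (\<chi> i. sgn (\<nu> $ i)) ** transpose P"
    by (simp add: S matrix_mul_assoc)
  finally show ?thesis by (simp add: QU)
qed

lemma matrix_sign_eqI:
  assumes "orthogonal_matrix Q" "A = Q ** diag_matrix \<mu> ** transpose Q"
  shows "matrix_sign A = Q ** diag_matrix (\<chi> i. sgn (\<mu> $ i)) ** transpose Q"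
  unfolding matrix_sign_def
proof (rule the_equality)
  show "\<exists>Qa \<mu>'. orthogonal_matrix Qa \<and> A = Qa ** diag_matrix \<mu>' ** transpose Qa \<and>
    Q ** diag_matrix (\<chi> i. sgn (\<mu> $ i)) ** transpose Q
      = Qa ** diag_matrix (\<chi> i. sgn (\<mu>' $ i)) ** transpose Qa"
    using assms by blast
qed (use assms matrix_sign_unique in metis)

lemma symmetric_matrix_inner:
  fixes A :: "real ^ 'n ^ 'n"
  assumes "transpose A = A"
  shows "(A *v x) \<bullet> y = x \<bullet> (A *v y)"
  by (metis assms dot_lmul_matrix vector_transpose_matrix)

lemma symmetric_matrix_extend_eigenvectors:
  fixes A :: "real ^ 'n ^ 'n"
  assumes A: "transpose A = A" and B: "finite B" "card B < CARD('n)"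
    and eig: "\<And>x. x \<in> B \<Longrightarrow> \<exists>\<mu>. A *v x = \<mu> *\<^sub>R x"
  shows "\<exists>v m. norm v = 1 \<and> (\<forall>x\<in>B. orthogonal x v) \<and> A *v v = m *\<^sub>R v"
proof -
  define W where "W = {y. \<forall>x\<in>B. orthogonal x y}"
  have W: "subspace W"
    unfolding W_def subspace_def by (auto simp: orthogonal_def inner_add_right)
  have "dim (span B) < DIM(real ^ 'n)"
    using B dim_le_card'[of B] by simp
  then have "span B \<noteq> UNIV" by (metis dim_UNIV less_irrefl)
  then have "span B \<subset> span UNIV" by auto
  then obtain w where "w \<noteq> 0" "\<And>y. y \<in> span B \<Longrightarrow> orthogonal w y"
    using orthogonal_to_subspace_exists_gen by metis
  then have w: "w \<noteq> 0" "w \<in> W"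
    unfolding W_def by (auto simp: orthogonal_commute span_base)
  define q where "q x = x \<bullet> (A *v x)" for x
  have lin: "linear (\<lambda>x. A *v x)" by simp
  have "compact (sphere 0 1 \<inter> W)"
    using W closed_subspace by (intro compact_Int_closed) auto
  moreover have "sphere 0 1 \<inter> W \<noteq> {}"
    using w subspace_scale[OF W w(2), of "inverse (norm w)"]
    by (auto intro!: exI[of _ "w /\<^sub>R norm w"] simp: disjoint_iff)
  moreover have "continuous_on (sphere 0 1 \<inter> W) q"
    unfolding q_def
    by (intro continuous_intros linear_continuous_on linear_conv_bounded_linear[THEN iffD1] lin)
  ultimately obtain v where v: "norm v = 1" "v \<in> W"
    and max: "\<And>y. norm y = 1 \<Longrightarrow> y \<in> W \<Longrightarrow> q y \<le> q v"
    using continuous_attains_sup[of "sphere 0 1 \<inter> W" q] by (metis IntE IntI mem_sphere_0)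
  define m where "m = q v"
  have le: "q y \<le> m * (y \<bullet> y)" if "y \<in> W" for y
  proof (cases "y = 0")
    case False
    have "q (y /\<^sub>R norm y) \<le> m"
      unfolding m_def using False that W by (intro max) (auto simp: subspace_scale)
    moreover have "q (y /\<^sub>R norm y) = q y / (norm y)\<^sup>2"
      unfolding q_def
      by (simp add: linear_cmul[OF lin] power2_eq_square divide_inverse)
    ultimately show ?thesis
      using False by (simp add: pos_divide_le_eq dot_square_norm)
  qed (simp add: q_def)
  have "A *v v \<in> W"
    unfolding W_def
  proof (clarsimp simp: orthogonal_def)
    fix x assume x: "x \<in> B"
    then obtain \<mu> where \<mu>: "A *v x = \<mu> *\<^sub>R x" using eig by blast
    have "x \<bullet> (A *v v) = (A *v x) \<bullet> v" by (simp add: symmetric_matrix_inner[OF A])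
    also have "\<dots> = 0" using v x by (simp add: \<mu> W_def orthogonal_def)
    finally show "x \<bullet> (A *v v) = 0" .
  qed
  then have uW: "A *v v - m *\<^sub>R v \<in> W"
    using W v by (simp add: subspace_diff subspace_scale)
  define u where "u = A *v v - m *\<^sub>R v"
  define c where "c = q u - m * (u \<bullet> u)"
  have vv: "v \<bullet> v = 1" using v by (simp add: dot_square_norm)
  have ineq: "2 * t * (u \<bullet> u) + t\<^sup>2 * c \<le> 0" for t
  proof -
    have "v + t *\<^sub>R u \<in> W"
      using v uW W by (simp add: u_def subspace_add subspace_scale)
    from le[OF this] have "q (v + t *\<^sub>R u) \<le> m * ((v + t *\<^sub>R u) \<bullet> (v + t *\<^sub>R u))" .
    moreover have "q (v + t *\<^sub>R u) = m + 2 * t * (u \<bullet> (A *v v)) + t\<^sup>2 * q u"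
      using symmetric_matrix_inner[OF A, of v u]
      by (simp add: q_def m_def linear_add[OF lin] linear_cmul[OF lin] inner_add_left
          inner_add_right power2_eq_square inner_commute algebra_simps)
    moreover have "(v + t *\<^sub>R u) \<bullet> (v + t *\<^sub>R u) = 1 + 2 * t * (u \<bullet> v) + t\<^sup>2 * (u \<bullet> u)"
      using vv by (simp add: inner_add_left inner_add_right power2_eq_square inner_commute
          algebra_simps)
    moreover have "u \<bullet> (A *v v) = u \<bullet> u + m * (u \<bullet> v)"
    proof -
      have "A *v v = u + m *\<^sub>R v" by (simp add: u_def)
      then show ?thesis by (simp add: inner_add_right)
    qed
    ultimately have "m + 2 * t * (u \<bullet> u + m * (u \<bullet> v)) + t\<^sup>2 * q u
        \<le> m * (1 + 2 * t * (u \<bullet> v) + t\<^sup>2 * (u \<bullet> u))"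
      by (simp only:)
    then show ?thesis
      unfolding c_def by (simp add: algebra_simps)
  qed
  have "u \<bullet> u = 0"
  proof (rule ccontr)
    assume "u \<bullet> u \<noteq> 0"
    then have uu: "u \<bullet> u > 0" by simp
    define t where "t = (u \<bullet> u) / (\<bar>c\<bar> + 1)"
    have t: "t > 0" using uu by (simp add: t_def)
    have "2 * (u \<bullet> u) + t * c \<le> 0"
    proof -
      have "t * (2 * (u \<bullet> u) + t * c) \<le> 0"
        using ineq[of t] by (simp add: power2_eq_square algebra_simps)
      then show ?thesis using t by (simp add: mult_le_0_iff)
    qed
    moreover have "- (t * c) \<le> u \<bullet> u"
    proof -
      have "- (t * c) \<le> t * (\<bar>c\<bar> + 1)"
        using t mult_left_mono[of "- c" "\<bar>c\<bar> + 1" t] by simp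
      also have "\<dots> = u \<bullet> u" unfolding t_def by simp
      finally show ?thesis .
    qed
    ultimately show False using uu by linarith
  qed
  then have "A *v v = m *\<^sub>R v" by (simp add: u_def)
  then show ?thesis using v W_def by blast
qed

lemma symmetric_matrix_diagonalisable:
  fixes A :: "real ^ 'n ^ 'n"
  assumes A: "transpose A = A"
  shows "\<exists>Q \<mu>. orthogonal_matrix Q \<and> A = Q ** diag_matrix \<mu> ** transpose Q"
proof -
  have "\<exists>B. finite B \<and> card B = k \<and> pairwise orthogonal B \<and> (\<forall>x\<in>B. norm x = 1)
      \<and> (\<forall>x\<in>B. \<exists>\<mu>. A *v x = \<mu> *\<^sub>R x)" if "k \<le> CARD('n)" for k
    using that
  proof (induction k)
    case 0
    show ?case by (rule exI[of _ "{}"]) simp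
  next
    case (Suc k)
    then obtain B where B: "finite B" "card B = k" "pairwise orthogonal B" "\<forall>x\<in>B. norm x = 1"
      "\<forall>x\<in>B. \<exists>\<mu>. A *v x = \<mu> *\<^sub>R x" by auto
    obtain v m where v: "norm v = 1" "\<forall>x\<in>B. orthogonal x v" "A *v v = m *\<^sub>R v"
      using symmetric_matrix_extend_eigenvectors[OF A, of B] B Suc.prems by auto
    have "v \<notin> B" using v by (auto simp: orthogonal_def)
    then show ?case
      using B v by (intro exI[of _ "insert v B"])
        (auto simp: pairwise_insert orthogonal_commute)
  qed
  then obtain B where B: "finite B" "card B = CARD('n)" "pairwise orthogonal B"
    "\<forall>x\<in>B. norm x = 1" "\<forall>x\<in>B. \<exists>\<mu>. A *v x = \<mu> *\<^sub>R x" by blast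
  obtain f :: "'n \<Rightarrow> real ^ 'n" where f: "bij_betw f UNIV B"
    using finite_same_card_bij[of "UNIV :: 'n set" B] B by auto
  have fB: "f i \<in> B" for i using f by (auto simp: bij_betw_def)
  obtain e where e: "\<And>x. x \<in> B \<Longrightarrow> A *v x = e x *\<^sub>R x" using B(5) by metis
  define Q :: "real ^ 'n ^ 'n" where "Q = (\<chi> i j. f j $ i)"
  define \<mu> :: "real ^ 'n" where "\<mu> = (\<chi> j. e (f j))"
  have col: "column j Q = f j" for j by (simp add: Q_def column_def)
  have Q: "orthogonal_matrix Q"
    unfolding orthogonal_matrix_orthonormal_columns col
    using B(3,4) fB f by (auto simp: pairwise_def bij_betw_def inj_on_def) metis
  have "A ** Q = Q ** diag_matrix \<mu>"
  proof -
    have "(A ** Q) $ i $ j = (A *v f j) $ i" for i j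
      by (simp add: matrix_matrix_mult_def matrix_vector_mult_def Q_def)
    then show ?thesis
      by (simp add: vec_eq_iff diag_matrix_mult_right e[OF fB] \<mu>_def) (simp add: Q_def)
  qed
  then have "Q ** diag_matrix \<mu> ** transpose Q = A ** (Q ** transpose Q)"
    by (simp add: matrix_mul_assoc)
  also have "\<dots> = A" using Q by (simp add: orthogonal_matrix_def)
  finally show ?thesis using Q by metis
qed

lemma matrix_sign_ex1:
  assumes "transpose A = A"
  shows "\<exists>!R. \<exists>Q \<mu>. orthogonal_matrix Q
      \<and> A = Q ** diag_matrix \<mu> ** transpose Q
      \<and> R = Q ** diag_matrix (\<chi> i. sgn (\<mu> $ i)) ** transpose Q"
  using symmetric_matrix_diagonalisable[OF assms] matrix_sign_unique by metis

end

theory Submission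
  imports Defs
begin

text \<open>The difference of the two directions is \<open>- (R' - R) g\<close>, so the bound is the defining
  inequality of the spectral norm as an operator norm.\<close>

lemma norm_matrix_vector_mult_le_spectral_norm:
  fixes M :: "real ^ 'n ^ 'm"
  shows "norm (M *v x) \<le> spectral_norm M * norm x"
  unfolding spectral_norm_def by (rule onorm) (rule matrix_vector_mul_bounded_linear)

theorem proposition3p3:
  fixes H A R R' :: "real ^ 'n ^ 'n" and s :: real and g d_ex d_ap :: "real ^ 'n"
  assumes "transpose H = H"
    and "A = H - s *\<^sub>R mat 1"
    and "R = matrix_sign A"
    and "transpose R' = R'"
    and "d_ex = - (R *v g)"
    and "d_ap = - (R' *v g)"
  shows "norm (d_ap - d_ex) \<le> spectral_norm (R' - R) * norm g"
proof -
  have "d_ap - d_ex = - ((R' - R) *v g)"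
    using assms by (simp add: matrix_vector_mult_diff_rdistrib)
  then have "norm (d_ap - d_ex) = norm ((R' - R) *v g)"
    by (simp only: norm_minus_cancel)
  also have "\<dots> \<le> spectral_norm (R' - R) * norm g"
    by (rule norm_matrix_vector_mult_le_spectral_norm)
  finally show ?thesis .
qed

end
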